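(* Let $P,Q,R$ be integers such that $x^3-Px^2-Qx-R=0$ has three distinct real roots $\alpha,\beta,\gamma$, and let $(G_n)_{n\ge 0}$ be defined by $G_{n+3}=PG_{n+2}+QG_{n+1}+RG_n$ with $G_0=0$, $G_1=0$, $G_2=1$. Let $n\ge 1$ and let $C_n(G)=\mathrm{circ}(G_1,G_2,\ldots,G_n)$ be the $n\times n$ circulant matrix whose first row is $(G_1,\ldots,G_n)$ and each subsequent row is the cyclic right shift of the preceding one. Put \[ K=\frac{PG_{n+1}-G_{n+2}+1-\sqrt{(PG_{n+1}-G_{n+2}+1)^2-4RG_nG_{n+1}}}{2G_{n+1}},\quad L=\frac{PG_{n+1}-G_{n+2}+1+\sqrt{(PG_{n+1}-G_{n+2}+1)^2-4RG_nG_{n+1}}}{2G_{n+1}}, \] $M=\alpha^n\beta^n+\beta^n\gamma^n+\alpha^n\gamma^n$, and $S_{n+1}=\alpha^n+\beta^n+\gamma^n$. Then \[ \det(C_n(G))=\frac{(G_{n+1})^n\left(1-K^n-L^n+K^nL^n\right)}{(-1)^n\left(1-S_{n+1}-R^n+M\right)}. \]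
   Context: $S_{n+1}=\alpha^n+\beta^n+\gamma^n$ is the $(n+1)$-st Generalized Tribonacci-Lucas number, i.e. the sequence with $S_{m+3}=PS_{m+2}+QS_{m+1}+RS_m$, $S_1=3$, $S_2=P$ (and $S_0=-Q/R$ when $R\neq0$). The square root denotes a (complex) square root; $G_{n+1}$ and $1-S_{n+1}-R^n+M$ are implicitly assumed nonzero so that the expressions are defined. *)

theory Defs
  imports Complex_Main "Jordan_Normal_Form.Determinant"
begin

fun gen_tribonacci :: "int \<Rightarrow> int \<Rightarrow> int \<Rightarrow> nat \<Rightarrow> int" where
  "gen_tribonacci P Q R 0 = 0"
| "gen_tribonacci P Q R (Suc 0) = 0"
| "gen_tribonacci P Q R (Suc (Suc 0)) = 1"
| "gen_tribonacci P Q R (Suc (Suc (Suc n))) =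
     P * gen_tribonacci P Q R (Suc (Suc n)) + Q * gen_tribonacci P Q R (Suc n)
       + R * gen_tribonacci P Q R n"

text \<open>The term \<open>+ length xs\<close> only keeps the natural-number subtraction from truncating:
  entry \<open>(i, j)\<close> is the element of \<open>xs\<close> at index \<open>j - i\<close> modulo \<open>length xs\<close>.\<close>

definition circ :: "'a list \<Rightarrow> 'a mat" where
  "circ xs = mat (length xs) (length xs)
     (\<lambda>(i, j). xs ! ((j + length xs - i) mod length xs))"

lemma circ_first_row:
  assumes "j < length xs"
  shows "circ xs $$ (0, j) = xs ! j"
proof -
  from assms have "0 < length xs" by linarith
  with assms show ?thesis by (simp add: circ_def del: length_greater_0_conv)
qed

lemma circ_right_shift:
  assumes "Suc i < length xs" "j < length xs"
  shows "circ xs $$ (Suc i, j) =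
    circ xs $$ (i, if j = 0 then length xs - 1 else j - 1)"
proof (cases j)
  case 0
  have "length xs - 1 + length xs - i = length xs + (length xs - Suc i)"
    using assms(1) by simp
  then have "(length xs - 1 + length xs - i) mod length xs = (length xs - Suc i) mod length xs"
    by simp
  moreover from assms have "0 < length xs" "length xs - 1 < length xs" by linarith+
  ultimately show ?thesis
    using 0 assms by (simp add: circ_def del: length_greater_0_conv)
next
  case (Suc k)
  with assms show ?thesis by (simp add: circ_def)
qed

end

theory Submission
  imports Defs
begin

text \<open>The circulant matrix is diagonalised by the matrix of \<open>n\<close>-th roots of unity, with eigenvalues
  \<open>f z = (\<Sum>k<n. G (k + 1) * z ^ k)\<close> for \<open>z ^ n = 1\<close>. By the recurrence the sum telescopes,
  \<open>f z * (1 - \<alpha> z) (1 - \<beta> z) (1 - \<gamma> z) = - G (n + 1) * (1 - K z) (1 - L z)\<close>, and multiplying over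
  all roots of unity gives the claim because \<open>1 - a z\<close> has product \<open>1 - a ^ n\<close>.\<close>

text \<open>Read both sides as polynomials in \<open>a\<close> of degree at most \<open>n\<close>.
  They agree at 0, where both are 1, and at the \<open>n\<close> roots of unity, where both vanish.
  Agreement at \<open>n + 1\<close> points forces equality.\<close>

lemma prod_roots_unity_one_minus:
  fixes a :: complex
  assumes n: "n > 0"
  shows "(\<Prod>z\<in>{z. z ^ n = 1}. 1 - a * z) = 1 - a ^ n"
proof -
  let ?U = "{z::complex. z ^ n = 1}"
  let ?p = "\<Prod>z\<in>?U. [:1, - z:]"
  have fin: "finite ?U" and card: "card ?U = n"
    using n by (simp_all add: finite_nth_roots card_nth_roots)
  have zero: "0 \<notin> ?U"
    using n by (simp add: power_0_left)
  have "?p = 1 - monom 1 n"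
  proof (rule poly_eqI_degree)
    fix x assume x: "x \<in> insert 0 ?U"
    show "poly ?p x = poly (1 - monom 1 n) x"
    proof (cases "x = 0")
      case True
      then show ?thesis
        using n by (simp add: poly_prod poly_monom)
    next
      case False
      then have "x ^ n = 1" using x by simp
      \<comment> \<open>The factor that vanishes at a root of unity \<open>x\<close> is the one
        indexed by its inverse.\<close>
      moreover from this have "inverse x \<in> ?U" "1 - x * inverse x = 0"
        using False by (simp_all add: power_inverse)
      then have "(\<Prod>z\<in>?U. 1 - x * z) = 0"
        using fin by (subst prod_zero_iff) blast+
      ultimately show ?thesis
        by (simp add: poly_prod poly_monom)
    qed
  next
    have "degree ?p \<le> (\<Sum>z\<in>?U. degree [:1, - z:])"
      by (rule degree_prod_sum_le[OF fin, unfolded o_def])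
    also have "\<dots> \<le> (\<Sum>z\<in>?U. 1)"
      by (rule sum_mono) simp
    finally show "degree ?p < card (insert 0 ?U)"
      using card fin zero by simp
    have "degree (1 - monom 1 n :: complex poly) \<le> n"
      by (intro degree_diff_le degree_monom_le) simp
    then show "degree (1 - monom 1 n :: complex poly) < card (insert 0 ?U)"
      using card fin zero by simp
  qed
  from arg_cong[OF this, of "\<lambda>p. poly p a"] show ?thesis
    by (simp add: poly_prod poly_monom)
qed

lemma sum_power_root_unity:
  fixes z :: complex
  assumes "z ^ n = 1"
  shows "(\<Sum>k<n. z ^ k) = (if z = 1 then of_nat n else 0)"
  using assms by (auto simp: sum_gp_strict)

text \<open>Row \<open>i\<close> of a circulant reads the list along this cyclic shift, so row sums
  can be reindexed by it. The inverse adds \<open>i\<close> back modulo \<open>n\<close>.\<close>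

lemma bij_betw_shift_mod:
  fixes i n :: nat
  assumes "i < n"
  shows "bij_betw (\<lambda>k. (k + n - i) mod n) {..<n} {..<n}"
proof (rule bij_betw_byWitness[where f' = "\<lambda>m. (m + i) mod n"])
  show "\<forall>k\<in>{..<n}. ((k + n - i) mod n + i) mod n = k"
  proof
    fix k assume "k \<in> {..<n}"
    moreover have "k + n - i + i = k + n" using assms by simp
    ultimately show "((k + n - i) mod n + i) mod n = k"
      by (simp add: mod_add_left_eq)
  qed
  show "\<forall>m\<in>{..<n}. ((m + i) mod n + n - i) mod n = m"
  proof
    fix m assume "m \<in> {..<n}"
    have "(m + i) mod n + n - i = (m + i) mod n + (n - i)"
      using assms by simp
    then have "((m + i) mod n + n - i) mod n = (m + i + (n - i)) mod n"
      by (metis mod_add_left_eq)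
    also have "m + i + (n - i) = m + n"
      using assms by simp
    finally show "((m + i) mod n + n - i) mod n = m"
      using \<open>m \<in> {..<n}\<close> by simp
  qed
qed (use assms in auto)

theorem det_circ:
  fixes xs :: "complex list"
  defines "n \<equiv> length xs"
  assumes "n > 0"
  shows "det (circ xs) = (\<Prod>z\<in>{z. z ^ n = 1}. \<Sum>k<n. xs ! k * z ^ k)"
proof -
  obtain w :: "nat \<Rightarrow> complex" where w: "bij_betw w {..<n} {z. z ^ n = 1}"
    using bij_betw_roots_unity[OF \<open>n > 0\<close>] by blast
  have unity: "w i ^ n = 1" if "i < n" for i
    using bij_betwE[OF w] that by auto
  have nonzero: "w i \<noteq> 0" if "i < n" for i
    using unity[OF that] \<open>n > 0\<close> by (auto simp: power_0_left)
  have inj: "w i = w j \<longleftrightarrow> i = j" if "i < n" "j < n" for i j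
    using w that by (auto simp: bij_betw_def inj_on_def)
  define ev where "ev z = (\<Sum>k<n. xs ! k * z ^ k)" for z
  \<comment> \<open>Column \<open>j\<close> of \<open>V\<close> lists the powers of
    \<open>w j\<close> and will be an eigenvector. \<open>W\<close> is \<open>n\<close> times the
    inverse of \<open>V\<close>, which shows invertibility without evaluating a Vandermonde
    determinant.\<close>
  define V where "V = mat n n (\<lambda>(i, j). w j ^ i)"
  define W where "W = mat n n (\<lambda>(i, j). inverse (w i) ^ j)"
  define D where "D = mat_diag n (\<lambda>j. ev (w j))"
  have C: "circ xs \<in> carrier_mat n n" and V: "V \<in> carrier_mat n n"
    and W: "W \<in> carrier_mat n n" and D: "D \<in> carrier_mat n n"
    by (simp_all add: circ_def V_def W_def D_def mat_diag_def n_def)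
  have "W * V = of_nat n \<cdot>\<^sub>m 1\<^sub>m n"
  proof (rule eq_matI)
    fix i j assume "i < dim_row (of_nat n \<cdot>\<^sub>m 1\<^sub>m n :: complex mat)"
      and "j < dim_col (of_nat n \<cdot>\<^sub>m 1\<^sub>m n :: complex mat)"
    then have ij: "i < n" "j < n" by simp_all
    have "(W * V) $$ (i, j) = (\<Sum>k<n. (w j / w i) ^ k)"
      using ij by (simp add: W_def V_def scalar_prod_def lessThan_atLeast0
          power_divide power_inverse divide_inverse power_mult_distrib mult.commute)
    \<comment> \<open>Orthogonality: the ratio is again an \<open>n\<close>-th root of unity, so its
      geometric sum vanishes unless the ratio is 1.\<close>
    also have "\<dots> = (if w j / w i = 1 then of_nat n else 0)"
      using ij by (intro sum_power_root_unity) (simp add: power_divide unity)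
    also have "\<dots> = (of_nat n \<cdot>\<^sub>m 1\<^sub>m n) $$ (i, j)"
      using ij nonzero[of i] inj[of i j] by (auto simp: divide_eq_1_iff)
    finally show "(W * V) $$ (i, j) = (of_nat n \<cdot>\<^sub>m 1\<^sub>m n) $$ (i, j)" .
  qed (simp_all add: W_def V_def)
  then have "det W * det V = of_nat n ^ n"
    using det_mult[OF W V] by (simp add: det_smult)
  then have V_nonzero: "det V \<noteq> 0"
    using \<open>n > 0\<close> by auto
  have "circ xs * V = V * D"
  proof (rule eq_matI)
    fix i j assume "i < dim_row (V * D)" and "j < dim_col (V * D)"
    then have ij: "i < n" "j < n" by (simp_all add: V_def D_def mat_diag_def)
    \<comment> \<open>Exponents of \<open>w j\<close> only matter modulo \<open>n\<close>. Splitting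
      off \<open>w j ^ i\<close> leaves the exponent equal to the list index, so what remains of the
      row sum is the same for every row.\<close>
    have pow: "w j ^ k = w j ^ i * w j ^ ((k + n - i) mod n)" for k
    proof -
      have "w j ^ (m mod n) = w j ^ (n * (m div n) + m mod n)" for m
        unfolding power_add power_mult unity[OF ij(2)] by simp
      then have "w j ^ ((k + n - i) mod n) = w j ^ (k + n - i)"
        by (simp only: mult_div_mod_eq)
      moreover have "i + (k + n - i) = k + n" using ij by simp
      then have "w j ^ i * w j ^ (k + n - i) = w j ^ k * w j ^ n"
        by (metis power_add)
      ultimately show ?thesis using unity[OF ij(2)] by simp
    qed
    have "(circ xs * V) $$ (i, j) = (\<Sum>k<n. xs ! ((k + n - i) mod n) * w j ^ k)"
      using ij by (simp add: circ_def V_def scalar_prod_def lessThan_atLeast0 n_def)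
    also have "\<dots> = (\<Sum>k<n. w j ^ i * (xs ! ((k + n - i) mod n) * w j ^ ((k + n - i) mod n)))"
      by (intro sum.cong refl) (subst pow, simp add: mult_ac)
    also have "\<dots> = (\<Sum>k<n. w j ^ i * (xs ! k * w j ^ k))"
      by (rule sum.reindex_bij_betw[OF bij_betw_shift_mod[OF ij(1)]])
    also have "\<dots> = w j ^ i * ev (w j)"
      by (simp add: ev_def sum_distrib_left)
    also have "\<dots> = (V * D) $$ (i, j)"
      using ij by (simp add: V_def D_def mat_diag_def scalar_prod_def if_distrib cong: if_cong)
    finally show "(circ xs * V) $$ (i, j) = (V * D) $$ (i, j)" .
  qed (simp_all add: V_def D_def mat_diag_def circ_def n_def)
  then have "det (circ xs) * det V = det V * det D"
    using det_mult[OF C V] det_mult[OF V D] by metis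
  then have "det (circ xs) = det D"
    using V_nonzero by simp
  also have "\<dots> = prod_list (diag_mat D)"
    by (rule det_upper_triangular[OF _ D]) (auto simp: D_def mat_diag_def)
  also have "\<dots> = (\<Prod>j<n. ev (w j))"
    by (simp add: D_def mat_diag_def prod_list_diag_prod lessThan_atLeast0)
  also have "\<dots> = (\<Prod>z\<in>{z. z ^ n = 1}. ev z)"
    by (rule prod.reindex_bij_betw[OF w])
  finally show ?thesis by (simp add: ev_def)
qed

lemma map_mat_circ: "map_mat f (circ xs) = circ (map f xs)"
  by (rule eq_matI) (auto simp: circ_def intro!: nth_map[symmetric] mod_less_divisor)

text \<open>The last factor is the reciprocal characteristic polynomial, so the recurrence cancels
  all inner coefficients. The \<open>x\<close> comes from the initial values, the rest from the
  truncation. The coefficient at \<open>x ^ (n + 1)\<close> is written with \<open>g (n + 2)\<close>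
  rather than \<open>g (n - 1)\<close>, so that induction can start at 0.\<close>

lemma gen_tribonacci_partial_gf:
  fixes P Q R :: int and x :: "'a :: comm_ring_1"
  defines "g \<equiv> \<lambda>k. of_int (gen_tribonacci P Q R k) :: 'a"
  shows "(\<Sum>k<n. g (Suc k) * x ^ k) * (1 - of_int P * x - of_int Q * x ^ 2 - of_int R * x ^ 3) =
    x - g (n + 1) * x ^ n - (g (n + 2) - of_int P * g (n + 1)) * x ^ (n + 1)
      - of_int R * g n * x ^ (n + 2)"
proof (induction n)
  case 0
  then show ?case by (simp add: g_def)
next
  case (Suc n)
  have "g (n + 3) = of_int P * g (n + 2) + of_int Q * g (n + 1) + of_int R * g n"
    by (simp add: g_def numeral_3_eq_3)
  then show ?case
    using Suc.IH by (simp add: algebra_simps power2_eq_square power3_eq_cube eval_nat_numeral)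
qed

text \<open>Divided differences: subtracting the equations of two roots and cancelling their
  difference lowers the degree. Doing this twice isolates \<open>p\<close>; then \<open>q\<close>
  and \<open>r\<close> follow by back substitution.\<close>

lemma cubic_vieta:
  fixes a b c p q r :: "'a :: idom"
  assumes "a ^ 3 - p * a ^ 2 - q * a - r = 0"
    and "b ^ 3 - p * b ^ 2 - q * b - r = 0"
    and "c ^ 3 - p * c ^ 2 - q * c - r = 0"
    and "a \<noteq> b" "b \<noteq> c" "a \<noteq> c"
  shows "p = a + b + c" "q = - (a * b + b * c + a * c)" "r = a * b * c"
proof -
  have factor: "x ^ 2 + x * y + y ^ 2 - p * (x + y) - q = 0"
    if "x ^ 3 - p * x ^ 2 - q * x - r = 0" "y ^ 3 - p * y ^ 2 - q * y - r = 0" "x \<noteq> y" for x y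
  proof -
    have "(x - y) * (x ^ 2 + x * y + y ^ 2 - p * (x + y) - q) =
        (x ^ 3 - p * x ^ 2 - q * x - r) - (y ^ 3 - p * y ^ 2 - q * y - r)"
      by (simp add: algebra_simps power2_eq_square power3_eq_cube)
    then show ?thesis
      using that by simp
  qed
  note ab = factor[OF assms(1,2,4)] and bc = factor[OF assms(2,3,5)]
  have "(a - c) * (a + b + c - p) =
      (a ^ 2 + a * b + b ^ 2 - p * (a + b) - q) - (b ^ 2 + b * c + c ^ 2 - p * (b + c) - q)"
    by (simp add: algebra_simps power2_eq_square)
  then have "(a - c) * (a + b + c - p) = 0"
    using ab bc by simp
  then show p: "p = a + b + c"
    using assms(6) by simp
  have "q = a ^ 2 + a * b + b ^ 2 - p * (a + b)"
    using ab by simp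
  then show q: "q = - (a * b + b * c + a * c)"
    by (simp add: p algebra_simps power2_eq_square)
  have "r = a ^ 3 - p * a ^ 2 - q * a"
    using assms(1) by simp
  then show "r = a * b * c"
    by (simp add: p q algebra_simps power2_eq_square power3_eq_cube)
qed

text \<open>Any complex square root \<open>s\<close> will do: changing its sign swaps
  \<open>K\<close> and \<open>L\<close>, and the formula is symmetric in them.\<close>

theorem theorem6:
  fixes P Q R :: int and \<alpha> \<beta> \<gamma> :: real and n :: nat
    and G :: "nat \<Rightarrow> int" and s K L :: complex and S M :: real
  assumes root_\<alpha>: "\<alpha> ^ 3 - of_int P * \<alpha> ^ 2 - of_int Q * \<alpha> - of_int R = 0"
    and root_\<beta>: "\<beta> ^ 3 - of_int P * \<beta> ^ 2 - of_int Q * \<beta> - of_int R = 0"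
    and root_\<gamma>: "\<gamma> ^ 3 - of_int P * \<gamma> ^ 2 - of_int Q * \<gamma> - of_int R = 0"
    and distinct_roots: "\<alpha> \<noteq> \<beta>" "\<beta> \<noteq> \<gamma>" "\<alpha> \<noteq> \<gamma>"
    and G: "G = gen_tribonacci P Q R"
    and n: "n \<ge> 1"
    and s: "s ^ 2 = of_int ((P * G (n + 1) - G (n + 2) + 1) ^ 2 - 4 * R * G n * G (n + 1))"
    and K: "K = (of_int (P * G (n + 1) - G (n + 2) + 1) - s) / (2 * of_int (G (n + 1)))"
    and L: "L = (of_int (P * G (n + 1) - G (n + 2) + 1) + s) / (2 * of_int (G (n + 1)))"
    and M: "M = \<alpha> ^ n * \<beta> ^ n + \<beta> ^ n * \<gamma> ^ n + \<alpha> ^ n * \<gamma> ^ n"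
    and S: "S = \<alpha> ^ n + \<beta> ^ n + \<gamma> ^ n"
    and G_nonzero: "G (n + 1) \<noteq> 0"
    and denom_nonzero: "1 - S - of_int R ^ n + M \<noteq> 0"
  shows "complex_of_int (det (circ (map G [1..<n + 1]))) =
    of_int (G (n + 1)) ^ n * (1 - K ^ n - L ^ n + K ^ n * L ^ n) /
      ((- 1) ^ n * complex_of_real (1 - S - of_int R ^ n + M))"
proof -
  note vieta = cubic_vieta[OF root_\<alpha> root_\<beta> root_\<gamma> distinct_roots]
  define a b c where "a = complex_of_real \<alpha>" and "b = complex_of_real \<beta>"
    and "c = complex_of_real \<gamma>"
  have P: "of_int P = a + b + c"
    using arg_cong[OF vieta(1), of complex_of_real] by (simp add: a_def b_def c_def)
  have Q: "of_int Q = - (a * b + b * c + a * c)"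
    using arg_cong[OF vieta(2), of complex_of_real] by (simp add: a_def b_def c_def)
  have R: "of_int R = a * b * c"
    using arg_cong[OF vieta(3), of complex_of_real] by (simp add: a_def b_def c_def)
  define g where "g k = complex_of_int (G k)" for k
  define f where "f z = (\<Sum>k<n. g (Suc k) * z ^ k)" for z
  define B where "B = complex_of_int (P * G (n + 1) - G (n + 2) + 1)"
  let ?U = "{z::complex. z ^ n = 1}"
  have g_nonzero: "g (n + 1) \<noteq> 0"
    using G_nonzero by (simp add: g_def)
  have B_eq: "B = of_int P * g (n + 1) - g (n + 2) + 1"
    by (simp add: B_def g_def)
  \<comment> \<open>\<open>K\<close> and \<open>L\<close> are the roots of
    \<open>g (n + 1) * X ^ 2 - B * X + of_int R * g n\<close>; only their sum and product are needed
    below.\<close>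
  have twice_K: "2 * g (n + 1) * K = B - s" and twice_L: "2 * g (n + 1) * L = B + s"
    using g_nonzero unfolding K L B_def[symmetric] g_def[symmetric] by simp_all
  have "2 * (g (n + 1) * (K + L)) = 2 * g (n + 1) * K + 2 * g (n + 1) * L"
    by (simp add: algebra_simps)
  then have sum_KL: "g (n + 1) * (K + L) = B"
    unfolding twice_K twice_L by simp
  have "4 * g (n + 1) * (g (n + 1) * (K * L)) = (2 * g (n + 1) * K) * (2 * g (n + 1) * L)"
    by (simp add: algebra_simps)
  also have "\<dots> = B ^ 2 - s ^ 2"
    unfolding twice_K twice_L by (simp add: algebra_simps power2_eq_square)
  also have "\<dots> = 4 * g (n + 1) * (of_int R * g n)"
    using s by (simp add: B_def g_def)
  finally have prod_KL: "g (n + 1) * (K * L) = of_int R * g n"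
    using g_nonzero by simp
  have eigenvalue: "f z * ((1 - a * z) * (1 - b * z) * (1 - c * z)) =
      - g (n + 1) * ((1 - K * z) * (1 - L * z))" if "z \<in> ?U" for z
  proof -
    \<comment> \<open>Since \<open>z ^ n = 1\<close>, the truncation terms fall to degrees 0, 1 and
      2. The isolated \<open>z\<close> supplies the \<open>+ 1\<close> in \<open>B\<close>.\<close>
    have "f z * (1 - of_int P * z - of_int Q * z ^ 2 - of_int R * z ^ 3) =
        z - g (n + 1) - (g (n + 2) - of_int P * g (n + 1)) * z - of_int R * g n * z ^ 2"
      using gen_tribonacci_partial_gf[of P Q R z n] that
      by (simp add: f_def g_def G power_add power2_eq_square)
    also have "\<dots> = - g (n + 1) + B * z - of_int R * g n * z ^ 2"
      by (simp add: B_eq algebra_simps)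
    also have "\<dots> = - g (n + 1) * ((1 - K * z) * (1 - L * z))"
      unfolding sum_KL[symmetric] prod_KL[symmetric]
      by (simp add: algebra_simps power2_eq_square)
    also have "1 - of_int P * z - of_int Q * z ^ 2 - of_int R * z ^ 3 =
        (1 - a * z) * (1 - b * z) * (1 - c * z)"
      unfolding P Q R by (simp add: algebra_simps power2_eq_square power3_eq_cube)
    finally show ?thesis .
  qed
  have det_eq: "complex_of_int (det (circ (map G [1..<n + 1]))) = (\<Prod>z\<in>?U. f z)"
  proof -
    let ?xs = "map complex_of_int (map G [1..<n + 1])"
    have "complex_of_int (det (circ (map G [1..<n + 1]))) = det (circ ?xs)"
      by (simp only: of_int_hom.hom_det[symmetric] map_mat_circ)
    also have "\<dots> = (\<Prod>z\<in>?U. \<Sum>k<n. ?xs ! k * z ^ k)"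
      using det_circ[of ?xs] n by simp
    also have "\<dots> = (\<Prod>z\<in>?U. f z)"
      unfolding f_def g_def by (intro prod.cong sum.cong refl) (simp del: upt_Suc)
    finally show ?thesis .
  qed
  have prod_U: "(\<Prod>z\<in>?U. 1 - x * z) = 1 - x ^ n" for x
    using n by (simp add: prod_roots_unity_one_minus)
  have card_U: "card ?U = n"
    using n by (simp add: card_nth_roots)
  \<comment> \<open>The eigenvalue identity is multiplied over all roots of unity before any
    division, so only the total product \<open>d\<close> has to be nonzero.\<close>
  have "(\<Prod>z\<in>?U. f z) * ((1 - a ^ n) * (1 - b ^ n) * (1 - c ^ n)) =
      (\<Prod>z\<in>?U. f z * ((1 - a * z) * (1 - b * z) * (1 - c * z)))"
    by (simp only: prod.distrib prod_U)
  also have "\<dots> = (\<Prod>z\<in>?U. - g (n + 1) * ((1 - K * z) * (1 - L * z)))"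
    by (rule prod.cong[OF refl eigenvalue])
  also have "\<dots> = (- g (n + 1)) ^ n * ((1 - K ^ n) * (1 - L ^ n))"
    by (simp only: prod.distrib prod_U prod_constant card_U)
  finally have main: "(\<Prod>z\<in>?U. f z) * ((1 - a ^ n) * (1 - b ^ n) * (1 - c ^ n)) =
      (- g (n + 1)) ^ n * ((1 - K ^ n) * (1 - L ^ n))" .
  define d where "d = complex_of_real (1 - S - of_int R ^ n + M)"
  have "d \<noteq> 0"
    unfolding d_def using denom_nonzero of_real_eq_0_iff by blast
  \<comment> \<open>\<open>S\<close>, \<open>M\<close> and \<open>of_int R ^ n\<close> are the
    elementary symmetric functions of the \<open>n\<close>-th powers of the roots.\<close>
  have d_eq: "d = (1 - a ^ n) * (1 - b ^ n) * (1 - c ^ n)"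
    by (simp add: d_def S M R a_def b_def c_def algebra_simps power_mult_distrib)
  have "(1 - K ^ n) * (1 - L ^ n) = 1 - K ^ n - L ^ n + K ^ n * L ^ n"
    by (simp add: algebra_simps)
  with main have "(\<Prod>z\<in>?U. f z) * d =
      (- 1) ^ n * (g (n + 1) ^ n * (1 - K ^ n - L ^ n + K ^ n * L ^ n))"
    by (simp only: d_eq power_minus[of "g (n + 1)"] mult.assoc)
  \<comment> \<open>The sign can change sides because its square is 1.\<close>
  then have "(\<Prod>z\<in>?U. f z) * ((- 1) ^ n * d) =
      g (n + 1) ^ n * (1 - K ^ n - L ^ n + K ^ n * L ^ n)"
    by (simp add: mult.left_commute flip: power_mult_distrib)
  then show ?thesis
    using \<open>d \<noteq> 0\<close> unfolding det_eq d_def[symmetric] g_def[symmetric]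
    by (simp add: eq_divide_eq)
qed

end
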